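(* Suppose $n$ and $T$ are integers satisfying $T \equiv n \pmod{2}$. Then $T \in \mathscr{S}(n)$ if and only if $4n - T^2$ is a sum of three integer squares, where $\mathscr{S}(n)$ denotes the set of all values $a+b+c+d$ with $a,b,c,d\in\mathbb{Z}$ and $a^2+b^2+c^2+d^2=n$.
   Context: For an integer $n$, the sum spectrum of $n$ is the set $\mathscr{S}(n) = \{a+b+c+d : a,b,c,d \in \mathbb{Z},\ a^2+b^2+c^2+d^2 = n\}$. An integer $m$ is a sum of three integer squares if $m = A^2+B^2+C^2$ for some $A,B,C\in\mathbb{Z}$ (zero allowed). *)

theory Defs
  imports "HOL-Number_Theory.Cong"
begin

definition sum_spectrum :: "int \<Rightarrow> int set" where
  "sum_spectrum n = {a + b + c + d | a b c d. a^2 + b^2 + c^2 + d^2 = n}"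

definition sum_of_three_squares :: "int \<Rightarrow> bool" where
  "sum_of_three_squares m \<longleftrightarrow> (\<exists>A B C :: int. m = A^2 + B^2 + C^2)"

end

theory Submission
  imports Defs
begin

text \<open>
  The Hadamard matrix with rows \<open>(1,1,1,1)\<close>, \<open>(1,1,-1,-1)\<close>, \<open>(1,-1,1,-1)\<close>, \<open>(1,-1,-1,1)\<close> is
  symmetric and has square 4, so it multiplies the sum of four squares by 4. Sending
  \<open>(a, b, c, d)\<close> to \<open>(T, A, B, C)\<close> by this matrix makes \<open>T\<close> the coordinate sum, and turns
  \<open>a\<^sup>2 + b\<^sup>2 + c\<^sup>2 + d\<^sup>2 = n\<close> into \<open>T\<^sup>2 + A\<^sup>2 + B\<^sup>2 + C\<^sup>2 = 4 n\<close>. This gives one direction.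

  Conversely, the inverse map is the same matrix divided by 4, so the question is integrality
  (lemma \<open>sum_spectrum_from_four_squares\<close>): it suffices that \<open>T, A, B, C\<close> share one
  parity and that 4 divides their sum. Equal parity follows modulo 4. Divisibility by 4 can be
  arranged in the odd case by changing the sign of \<open>C\<close>, which alters the sum by 2 modulo 4; in the
  even case halving everything leaves four squares with sum \<open>n\<close>, and \<open>n\<close> is even.
\<close>

text \<open>A square is 0 or 1 modulo 4 according to parity, so the number of odd terms is 0 or 4.\<close>

lemma four_squares_same_parity:
  fixes T A B C :: int
  assumes "4 dvd T^2 + A^2 + B^2 + C^2"
  shows "even A \<longleftrightarrow> even T" "even B \<longleftrightarrow> even T" "even C \<longleftrightarrow> even T"
proof -
  have square: "\<exists>k. x^2 = 4 * k + x mod 2" for x :: int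
  proof (cases "even x")
    case True
    then obtain y where "x = 2 * y" by blast
    then show ?thesis by (auto simp: power2_eq_square)
  next
    case False
    then obtain y where "x = 2 * y + 1" by (blast elim: oddE)
    then have "x^2 = 4 * (y * y + y) + x mod 2"
      by (simp add: power2_eq_square algebra_simps)
    then show ?thesis by blast
  qed
  obtain t a b c where
    "T^2 = 4 * t + T mod 2" "A^2 = 4 * a + A mod 2" "B^2 = 4 * b + B mod 2" "C^2 = 4 * c + C mod 2"
    using square by meson
  moreover obtain k where "T^2 + A^2 + B^2 + C^2 = 4 * k" using assms by blast
  ultimately have "T mod 2 + A mod 2 + B mod 2 + C mod 2 = 4 * (k - t - a - b - c)"
    by algebra
  then show "even A \<longleftrightarrow> even T" "even B \<longleftrightarrow> even T" "even C \<longleftrightarrow> even T"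
    by presburger+
qed

text \<open>
  Integrality of the inverse Hadamard transform: the first coordinate of the preimage is a quarter
  of the total, and each other coordinate differs from it by half the sum of two entries of equal
  parity.
\<close>

lemma sum_spectrum_from_four_squares:
  fixes n T A B C :: int
  assumes squares: "T^2 + A^2 + B^2 + C^2 = 4 * n"
    and "4 dvd T + A + B + C"
    and "even A \<longleftrightarrow> even T" "even B \<longleftrightarrow> even T" "even C \<longleftrightarrow> even T"
  shows "T \<in> sum_spectrum n"
proof -
  obtain a where a: "T + A + B + C = 4 * a" using assms(2) by blast
  have "even (B + C)" "even (A + C)" "even (A + B)" using assms(3-5) by auto
  then obtain r s t where rst: "B + C = 2 * r" "A + C = 2 * s" "A + B = 2 * t" by (meson dvdE)
  have entries: "A = s + t - r" "B = r + t - s" "C = r + s - t" "T = 4 * a - r - s - t"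
    using a rst by linarith+
  have "4 * (a^2 + (a - r)^2 + (a - s)^2 + (a - t)^2) = T^2 + A^2 + B^2 + C^2"
    unfolding entries by (simp add: power2_eq_square algebra_simps)
  then have "4 * (a^2 + (a - r)^2 + (a - s)^2 + (a - t)^2) = 4 * n"
    using squares by (rule trans)
  then have "a^2 + (a - r)^2 + (a - s)^2 + (a - t)^2 = n"
    by (simp only: mult_cancel_left) simp
  moreover have "T = a + (a - r) + (a - s) + (a - t)" using entries by linarith
  ultimately show ?thesis unfolding sum_spectrum_def by blast
qed

theorem theorem2:
  fixes n T :: int
  assumes "[T = n] (mod 2)"
  shows "T \<in> sum_spectrum n \<longleftrightarrow> sum_of_three_squares (4 * n - T^2)"
proof
  assume "T \<in> sum_spectrum n"
  then obtain a b c d where "T = a + b + c + d" "n = a^2 + b^2 + c^2 + d^2"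
    unfolding sum_spectrum_def by blast
  then have "4 * n - T^2 = (a + b - c - d)^2 + (a - b + c - d)^2 + (a - b - c + d)^2"
    by (simp add: power2_eq_square algebra_simps)
  then show "sum_of_three_squares (4 * n - T^2)" unfolding sum_of_three_squares_def by blast
next
  assume "sum_of_three_squares (4 * n - T^2)"
  then obtain A B C where "4 * n - T^2 = A^2 + B^2 + C^2"
    unfolding sum_of_three_squares_def by blast
  then have squares: "T^2 + A^2 + B^2 + C^2 = 4 * n" by linarith
  then have "4 dvd T^2 + A^2 + B^2 + C^2" by simp
  note parity = four_squares_same_parity[OF this]
  show "T \<in> sum_spectrum n"
  proof (cases "even T")
    case True
    with parity have "even A" "even B" "even C" by auto
    with True obtain t a b c where halves: "T = 2 * t" "A = 2 * a" "B = 2 * b" "C = 2 * c"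
      by (meson dvdE)
    with squares have "t^2 + a^2 + b^2 + c^2 = n" by simp
    moreover have "even n" using assms True by (simp add: cong_dvd_iff)
    ultimately have "even (t^2 + a^2 + b^2 + c^2)" by simp
    then have "even (t + a + b + c)" by simp
    then have "4 dvd T + A + B + C" unfolding halves by presburger
    with squares parity show ?thesis by (blast intro: sum_spectrum_from_four_squares)
  next
    case False
    with parity have "odd A" "odd B" "odd C" by auto
    with False have "4 dvd T + A + B + C \<or> 4 dvd T + A + B + (- C)" by presburger
    then show ?thesis
      using sum_spectrum_from_four_squares[of T A B C n]
        sum_spectrum_from_four_squares[of T A B "- C" n] squares parity
      by auto
  qed
qed

end
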